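(* Let $H=(V,E)$ be a hypergraph all of whose edges are finite sets, such that for every finite subset $E_0\subseteq E$ the hypergraph $(V,E_0)$ satisfies König's Weak Property. Then $H$ satisfies König's Weak Property.
   Context: A hypergraph is a pair $H=(V,E)$ where $V$ is a set (possibly infinite) and $E$ is a set (possibly infinite) of non-empty subsets of $V$, called edges. A (vertex) cover of $H$ is a set $C\subseteq V$ such that $C\cap e\neq\emptyset$ for all $e\in E$. The covering number $\nu(H)$ is the minimal cardinality (a possibly infinite cardinal) of a cover of $H$. A matching is a set $M\subseteq E$ of pairwise disjoint edges (possibly empty). $H$ has König's Weak Property if there is a matching $M\subseteq E$ with $|M|=\nu(H)$ (equality of cardinals). *)

theory Defs
  imports Main
begin

unbundle cardinal_syntax

definition hypergraph :: "'a set \<Rightarrow> 'a set set \<Rightarrow> bool" where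
  "hypergraph V E \<longleftrightarrow> (\<forall>e\<in>E. e \<subseteq> V \<and> e \<noteq> {})"

definition cover :: "'a set \<Rightarrow> 'a set set \<Rightarrow> 'a set \<Rightarrow> bool" where
  "cover V E C \<longleftrightarrow> C \<subseteq> V \<and> (\<forall>e\<in>E. C \<inter> e \<noteq> {})"

definition matching :: "'a set set \<Rightarrow> 'a set set \<Rightarrow> bool" where
  "matching E M \<longleftrightarrow> M \<subseteq> E \<and> (\<forall>e\<in>M. \<forall>f\<in>M. e \<noteq> f \<longrightarrow> e \<inter> f = {})"

text \<open>
  Cardinals are well-order relations, identified up to the order isomorphism \<open>=o\<close>. The covering
  number is the cardinal of a cover of minimal cardinality. Such covers exist in every
  hypergraph, and the choice of one does not matter up to \<open>=o\<close>; see the two lemmas below.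
\<close>

definition min_cover :: "'a set \<Rightarrow> 'a set set \<Rightarrow> 'a set \<Rightarrow> bool" where
  "min_cover V E C \<longleftrightarrow> cover V E C \<and> (\<forall>D. cover V E D \<longrightarrow> |C| \<le>o |D| )"

definition covering_number :: "'a set \<Rightarrow> 'a set set \<Rightarrow> 'a rel" where
  "covering_number V E = |SOME C. min_cover V E C|"

lemma min_cover_exists:
  assumes "hypergraph V E"
  shows "\<exists>C. min_cover V E C"
proof -
  have "cover V E V"
    using assms by (auto simp: hypergraph_def cover_def)
  then have "card_of ` {C. cover V E C} \<noteq> {}"
    by blast
  moreover have "\<forall>r \<in> card_of ` {C. cover V E C}. Card_order r"
    by (auto intro: card_of_Card_order)
  ultimately show ?thesis
    using exists_minim_Card_order[of "card_of ` {C. cover V E C}"]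
    unfolding min_cover_def by blast
qed

lemma covering_number_min_cover:
  assumes "min_cover V E C"
  shows "covering_number V E =o |C|"
proof -
  have "min_cover V E (SOME C. min_cover V E C)"
    using assms by (rule someI)
  then show ?thesis
    using assms unfolding covering_number_def min_cover_def ordIso_iff_ordLeq by blast
qed

definition konig_weak_property :: "'a set \<Rightarrow> 'a set set \<Rightarrow> bool" where
  "konig_weak_property V E \<longleftrightarrow> (\<exists>M. matching E M \<and> |M| =o covering_number V E)"

end

theory Submission
  imports Defs
begin

text \<open>
  Choosing a point of a cover in each edge of a matching shows that no matching is larger than a
  cover. If a minimal cover is infinite, a maximal matching \<open>M\<close> suffices: \<open>\<Union>M\<close> is a cover, and it is
  no larger than \<open>M\<close> because the edges are finite. If a minimal cover has \<open>k\<close> elements, then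
  already finitely many edges cannot be covered by fewer than \<open>k\<close> points, so the hypothesis gives
  a matching of size \<open>k\<close>.
\<close>

text \<open>Frees later arguments from the \<open>SOME\<close> in \<open>covering_number\<close>:
  any minimal cover may stand for it, since all of them are equinumerous.\<close>

lemma konig_weak_property_min_cover:
  assumes "min_cover V E C"
  shows "konig_weak_property V E \<longleftrightarrow> (\<exists>M. matching E M \<and> |M| =o |C| )"
  using covering_number_min_cover[OF assms] unfolding konig_weak_property_def
  by (blast intro: ordIso_transitive ordIso_symmetric)

lemma matching_ordLeq_cover:
  assumes "matching E M" and "cover V E C"
  shows "|M| \<le>o |C|"
proof -
  have "\<forall>e\<in>M. C \<inter> e \<noteq> {}"
    using assms subsetD unfolding matching_def cover_def by metis
  then have "\<forall>e\<in>M. \<exists>v. v \<in> C \<inter> e"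
    by (simp only: ex_in_conv simp_thms)
  from bchoice[OF this] obtain p where p: "\<forall>e\<in>M. p e \<in> C \<inter> e" ..
  have disj: "\<forall>e\<in>M. \<forall>f\<in>M. e \<noteq> f \<longrightarrow> e \<inter> f = {}"
    using assms(1) unfolding matching_def by (rule conjunct2)
  have "inj_on p M"
  proof (rule inj_onI)
    fix e f assume ef: "e \<in> M" "f \<in> M" "p e = p f"
    have "p e \<in> e" "p f \<in> f"
      using p ef(1,2) by simp_all
    then have "e \<inter> f \<noteq> {}"
      using ef(3) by auto
    then show "e = f"
      using disj ef(1,2) by metis
  qed
  moreover have "\<And>e. e \<in> M \<Longrightarrow> p e \<in> C"
    using p by simp
  ultimately show ?thesis
    by (rule card_of_ordLeqI)
qed

text \<open>Zorn's lemma: two edges in the union of a chain of matchings already lie in a common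
  member of the chain, so they are disjoint or equal.\<close>

lemma maximal_matching_exists:
  "\<exists>M. matching E M \<and> (\<forall>N. matching E N \<longrightarrow> M \<subseteq> N \<longrightarrow> N = M)"
proof -
  have "\<exists>M\<in>{M. matching E M}. \<forall>N\<in>{M. matching E M}. M \<subseteq> N \<longrightarrow> N = M"
  proof (rule subset_Zorn')
    fix \<C> assume "subset.chain {M. matching E M} \<C>"
    then have match: "\<And>M. M \<in> \<C> \<Longrightarrow> matching E M"
      and chain: "\<And>M N. M \<in> \<C> \<Longrightarrow> N \<in> \<C> \<Longrightarrow> M \<subseteq> N \<or> N \<subseteq> M"
      unfolding subset_chain_def by blast+
    have "e \<inter> f = {}" if ef: "e \<in> \<Union>\<C>" "f \<in> \<Union>\<C>" "e \<noteq> f" for e f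
    proof -
      obtain M N where "M \<in> \<C>" "N \<in> \<C>" "e \<in> M" "f \<in> N"
        using ef by blast
      then obtain K where "K \<in> \<C>" "e \<in> K" "f \<in> K"
        using chain by blast
      then show ?thesis
        using match ef(3) unfolding matching_def by blast
    qed
    moreover have "\<Union>\<C> \<subseteq> E"
      using match unfolding matching_def by blast
    ultimately show "\<Union>\<C> \<in> {M. matching E M}"
      unfolding matching_def by blast
  qed
  then show ?thesis
    by simp
qed

lemma cover_Union_maximal_matching:
  assumes "hypergraph V E" and M: "matching E M"
    and max: "\<forall>N. matching E N \<longrightarrow> M \<subseteq> N \<longrightarrow> N = M"
  shows "cover V E (\<Union>M)"
proof -
  have "\<Union>M \<inter> e \<noteq> {}" if e: "e \<in> E" for e
  proof
    assume disj: "\<Union>M \<inter> e = {}"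
    then have "matching E (insert e M)"
      using M e unfolding matching_def by blast
    then have "e \<in> M"
      using max by blast
    \<comment> \<open>Membership in \<open>M\<close> gives \<open>e \<subseteq> \<Union>M\<close>,
      so a set disjoint from \<open>\<Union>M\<close> would have to be empty.\<close>
    moreover have "e \<noteq> {}"
      using assms(1) e unfolding hypergraph_def by blast
    ultimately show False
      using disj by blast
  qed
  moreover have "\<Union>M \<subseteq> V"
    using assms(1) M unfolding matching_def hypergraph_def by blast
  ultimately show ?thesis
    unfolding cover_def by simp
qed

text \<open>Each edge is smaller than the infinite \<open>M\<close>, and an infinite cardinal
  absorbs a union of that many sets no larger than itself.\<close>

lemma card_of_Union_finite_ordLeq:
  assumes "infinite M" and "\<forall>e\<in>M. finite e"
  shows "|\<Union>M| \<le>o |M|"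
proof -
  have "|e| \<le>o |M|" if "e \<in> M" for e
    using assms that ordLeq_total[OF card_of_Well_order card_of_Well_order, of e M]
      card_of_ordLeq_finite by blast
  then have "|\<Union>e\<in>M. e| \<le>o |M|"
    using assms(1) by (intro card_of_UNION_ordLeq_infinite card_of_mono1) auto
  then show ?thesis
    by simp
qed

lemma card_of_ordLeq_iff_card_le:
  assumes "finite A" and "finite B"
  shows "|A| \<le>o |B| \<longleftrightarrow> card A \<le> card B"
  using card_of_ordLeq[of A B] inj_on_iff_card_le[OF assms] by simp

text \<open>A compactness argument by induction on \<open>k\<close>. Every cover meets a fixed edge
  \<open>e\<close> in some \<open>v\<close>, and the edges avoiding \<open>v\<close> still require
  \<open>k\<close> further points. The induction hypothesis yields a finite witness
  \<open>F v\<close> for each \<open>v\<close>; as \<open>e\<close> is finite, only finitely many of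
  these have to be collected.\<close>

lemma finite_subfamily_not_coverable:
  assumes "\<forall>e\<in>E. finite e"
    and "\<And>C. \<lbrakk>finite C; \<forall>e\<in>E. C \<inter> e \<noteq> {}\<rbrakk> \<Longrightarrow> k \<le> card C"
  shows "\<exists>E0\<subseteq>E. finite E0 \<and> (\<forall>C. finite C \<longrightarrow> (\<forall>e\<in>E0. C \<inter> e \<noteq> {}) \<longrightarrow> k \<le> card C)"
  using assms
proof (induction k arbitrary: E)
  case 0
  then show ?case by blast
next
  case (Suc k)
  \<comment> \<open>Otherwise the empty set would cover \<open>E\<close> with fewer than
    \<open>Suc k\<close> points.\<close>
  have "E \<noteq> {}"
    using Suc.prems(2)[of "{}"] by auto
  then obtain e where e: "e \<in> E" by blast
  \<comment> \<open>A cover of the edges avoiding \<open>v\<close>, together with \<open>v\<close>, covers all edges.\<close>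
  have "\<exists>E0\<subseteq>{f \<in> E. v \<notin> f}. finite E0 \<and>
      (\<forall>C. finite C \<longrightarrow> (\<forall>f\<in>E0. C \<inter> f \<noteq> {}) \<longrightarrow> k \<le> card C)" for v
  proof (rule Suc.IH)
    show "\<forall>f\<in>{f \<in> E. v \<notin> f}. finite f"
      using Suc.prems(1) by blast
    fix C assume C: "finite C" "\<forall>f\<in>{f \<in> E. v \<notin> f}. C \<inter> f \<noteq> {}"
    have "\<forall>f\<in>E. insert v C \<inter> f \<noteq> {}"
      using C(2) by blast
    then have "Suc k \<le> card (insert v C)"
      using Suc.prems(2)[of "insert v C"] C(1) by simp
    then show "k \<le> card C"
      using C(1) by (simp add: card_insert_if split: if_splits)
  qed
  then obtain F where F: "\<And>v. F v \<subseteq> {f \<in> E. v \<notin> f}" "\<And>v. finite (F v)"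
    and cov: "\<And>v C. \<lbrakk>finite C; \<forall>f\<in>F v. C \<inter> f \<noteq> {}\<rbrakk> \<Longrightarrow> k \<le> card C"
    by metis
  let ?E0 = "insert e (\<Union>v\<in>e. F v)"
  have "Suc k \<le> card C" if C: "finite C" "\<forall>f\<in>?E0. C \<inter> f \<noteq> {}" for C
  proof -
    obtain v where v: "v \<in> C" "v \<in> e"
      using C(2) by blast
    \<comment> \<open>Edges in \<open>F v\<close> avoid \<open>v\<close>, so \<open>C\<close> meets
      them elsewhere and \<open>v\<close> counts as an extra point.\<close>
    have "\<forall>f\<in>F v. (C - {v}) \<inter> f \<noteq> {}"
      using C(2) v(2) F(1)[of v] by blast
    then have "k \<le> card (C - {v})"
      using cov C(1) by blast
    then show ?thesis
      using card_Suc_Diff1[OF C(1) v(1)] by linarith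
  qed
  moreover have "?E0 \<subseteq> E" "finite ?E0"
    using e F Suc.prems(1) by auto
  ultimately show ?case by blast
qed

lemma konig_weak_property_infinite_cover:
  assumes H: "hypergraph V E" and fin: "\<forall>e\<in>E. finite e"
    and C: "min_cover V E C" "infinite C"
  shows "konig_weak_property V E"
proof -
  obtain M where M: "matching E M" "\<forall>N. matching E N \<longrightarrow> M \<subseteq> N \<longrightarrow> N = M"
    using maximal_matching_exists[of E] by blast
  have finM: "\<forall>e\<in>M. finite e"
    using M(1) fin unfolding matching_def by blast
  have le: "|C| \<le>o |\<Union>M|"
    using cover_Union_maximal_matching[OF H M] C(1) unfolding min_cover_def by blast
  then have "infinite (\<Union>M)"
    using C(2) card_of_ordLeq_infinite by blast
  \<comment> \<open>A finite union of finite edges would be finite.\<close>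
  then have "infinite M"
    using finM by blast
  then have "|C| \<le>o |M|"
    using le card_of_Union_finite_ordLeq finM ordLeq_transitive by blast
  moreover have "|M| \<le>o |C|"
    using matching_ordLeq_cover M(1) C(1) unfolding min_cover_def by blast
  ultimately show ?thesis
    using konig_weak_property_min_cover[OF C(1)] M(1) ordIso_iff_ordLeq by blast
qed

lemma konig_weak_property_finite_cover:
  assumes H: "hypergraph V E" and fin: "\<forall>e\<in>E. finite e"
    and konig: "\<And>E0. E0 \<subseteq> E \<Longrightarrow> finite E0 \<Longrightarrow> konig_weak_property V E0"
    and C: "min_cover V E C" "finite C"
  shows "konig_weak_property V E"
proof -
  have "\<exists>E0\<subseteq>E. finite E0 \<and>
      (\<forall>D. finite D \<longrightarrow> (\<forall>e\<in>E0. D \<inter> e \<noteq> {}) \<longrightarrow> card C \<le> card D)"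
  proof (rule finite_subfamily_not_coverable[OF fin])
    fix D assume D: "finite D" "\<forall>e\<in>E. D \<inter> e \<noteq> {}"
    \<comment> \<open>\<open>D\<close> may leave \<open>V\<close>, while \<open>cover\<close> does
      not allow this; trimming \<open>D\<close> to \<open>V\<close> meets the edges in the same
      points.\<close>
    have "(D \<inter> V) \<inter> e = D \<inter> e" if "e \<in> E" for e
      using H that unfolding hypergraph_def by blast
    then have "cover V E (D \<inter> V)"
      using D(2) unfolding cover_def by simp
    then have "|C| \<le>o |D \<inter> V|"
      using C(1) unfolding min_cover_def by blast
    then have "card C \<le> card (D \<inter> V)"
      using C(2) D(1) card_of_ordLeq_iff_card_le[of C "D \<inter> V"] by blast
    also have "\<dots> \<le> card D"
      using D(1) by (simp add: card_mono)
    finally show "card C \<le> card D" .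
  qed
  then obtain E0 where E0: "E0 \<subseteq> E" "finite E0"
    and large: "\<And>D. \<lbrakk>finite D; \<forall>e\<in>E0. D \<inter> e \<noteq> {}\<rbrakk> \<Longrightarrow> card C \<le> card D"
    by blast
  have "hypergraph V E0"
    using H E0(1) unfolding hypergraph_def by blast
  then obtain D where D: "min_cover V E0 D"
    using min_cover_exists by blast
  then obtain M where M: "matching E0 M" "|M| =o |D|"
    using konig[OF E0] konig_weak_property_min_cover by blast
  \<comment> \<open>The bound \<open>large\<close> speaks of finite sets only; finiteness of
    \<open>D\<close> comes from the equinumerous \<open>M\<close>, a subset of the finite
    \<open>E0\<close>.\<close>
  have "finite M"
    using M(1) E0(2) finite_subset unfolding matching_def by blast
  then have "finite D"
    using M(2) card_of_ordIso_finite by blast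
  then have "card C \<le> card D"
    using large D unfolding min_cover_def cover_def by blast
  then have "|C| \<le>o |D|"
    using C(2) \<open>finite D\<close> card_of_ordLeq_iff_card_le by blast
  then have "|C| \<le>o |M|"
    using M(2) ordIso_symmetric ordLeq_ordIso_trans by blast
  moreover have "matching E M"
    using M(1) E0(1) unfolding matching_def by blast
  moreover from this have "|M| \<le>o |C|"
    using matching_ordLeq_cover C(1) unfolding min_cover_def by blast
  ultimately show ?thesis
    using konig_weak_property_min_cover[OF C(1)] ordIso_iff_ordLeq by blast
qed

theorem proposition3p5:
  fixes V :: "'a set" and E :: "'a set set"
  assumes "hypergraph V E"
    and "\<forall>e\<in>E. finite e"
    and "\<forall>E0. E0 \<subseteq> E \<and> finite E0 \<longrightarrow> konig_weak_property V E0"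
  shows "konig_weak_property V E"
proof -
  obtain C where C: "min_cover V E C"
    using min_cover_exists[OF assms(1)] by blast
  show ?thesis
  proof (cases "finite C")
    case True
    then show ?thesis
      using konig_weak_property_finite_cover[OF assms(1,2) _ C] assms(3) by blast
  next
    case False
    then show ?thesis
      using konig_weak_property_infinite_cover[OF assms(1,2) C] by blast
  qed
qed

end
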